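(* For all $\alpha>0$, $\beta>0$ and $t\in\mathbb{R}$: \begin{align*} (1)\quad & \int_{-\infty}^{0}(e^{itx}-1-itx)\,e^{\alpha x}\,\frac{\alpha(1-e^x)+e^{x}}{(1-e^x)^2}\,dx = it\big(\Psi^{(0)}(\alpha +it)-\Psi^{(0)}(\alpha)\big);\\ (2)\quad & \int_{0}^\infty (e^{-itx}-1 +itx)\,e^{-\beta x}\,\frac{\beta(1-e^{-x}) +e^{-x}}{(1-e^{-x})^2}\,dx= it\big(\Psi^{(0)}(\beta +it)-\Psi^{(0)}(\beta)\big). \end{align*}
   Context: $\Psi^{(0)}(z)=\frac{d}{dz}\log\Gamma(z)=\Gamma'(z)/\Gamma(z)$ is the digamma function. *)

theory Defs
  imports "HOL-Analysis.Analysis"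
begin

text \<open>
  The library introduces \<^term>\<open>Digamma\<close> as a series; off the poles it is the logarithmic
  derivative of the Gamma function.
\<close>

lemma Digamma_eq_deriv_Gamma_div_Gamma:
  fixes z :: complex
  assumes "z \<notin> \<int>\<^sub>\<le>\<^sub>0"
  shows "Digamma z = deriv Gamma z / Gamma z"
proof -
  have "deriv Gamma z = Gamma z * Digamma z"
    by (rule DERIV_imp_deriv, rule has_field_derivative_Gamma, rule assms)
  with assms show ?thesis
    by (simp add: Gamma_eq_zero_iff)
qed

end

theory Submission
  imports Defs "HOL-Real_Asymp.Real_Asymp"
begin

text \<open>
  Put \<open>q = exp (- x)\<close> with \<open>x > 0\<close>. The kernel of the second integral is a superposition of
  exponential weights,
  \<open>q powr \<beta> * (\<beta> * (1 - q) + q) / (1 - q)\<^sup>2 = (\<Sum>n. (\<beta> + n) * exp (- (\<beta> + n) * x))\<close>,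
  by the geometric series and its derivative (\<open>exponential_mixture_sums\<close>). Against a single
  exponential weight the compensated character has an elementary integral
  (\<open>exponential_integral\<close>):
  \<open>\<integral>\<^sub>0\<^sup>\<infinity> (exp (- \<i>tx) - 1 + \<i>tx) * c * exp (- c * x) dx = \<i>t * (1 / c - 1 / (c + \<i>t))\<close>.
  Taking \<open>c = \<beta> + n\<close> and summing over \<open>n\<close> produces \<open>\<i>t\<close> times the series for the difference
  of the values of the digamma function at \<open>\<beta> + \<i>t\<close> and \<open>\<beta>\<close>.

  What makes the compensator \<open>- 1 + \<i>tx\<close> necessary is the double pole of the kernel at \<open>x = 0\<close>:
  it turns the character into a factor of size at most \<open>(tx)\<^sup>2\<close>. The same bound justifies
  integrating termwise, because the \<open>n\<close>-th summand then has \<open>L\<^sup>1\<close> norm at most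
  \<open>2t\<^sup>2 / (\<beta> + n)\<^sup>2\<close>. The first integral is the second one with \<open>x\<close> replaced by \<open>- x\<close>.
\<close>

section \<open>The compensated character against one exponential weight\<close>

lemma norm_compensated_character_le:
  fixes t x :: real
  shows "norm (exp (- (\<i> * of_real t * of_real x)) - 1 + \<i> * of_real t * of_real x) \<le> (t * x)\<^sup>2"
proof -
  have "norm (exp (- (\<i> * of_real t * of_real x)) - (\<Sum>k\<le>1. (- (\<i> * of_real t * of_real x)) ^ k / fact k))
      \<le> (t * x)\<^sup>2"
    using Taylor_exp[of "- (\<i> * of_real t * of_real x)" 1]
    by (simp add: norm_mult power2_eq_square abs_mult[symmetric])
  then show ?thesis
    by (simp add: algebra_simps)
qed

lemma exponential_second_moment:
  fixes c :: real
  assumes "c > 0"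
  shows "set_integrable lborel {0<..} (\<lambda>x. x\<^sup>2 * (c * exp (- c * x)))" (is ?int)
    and "(LBINT x:{0<..}. x\<^sup>2 * (c * exp (- c * x))) = 2 / c\<^sup>2" (is ?val)
proof -
  define F where "F = (\<lambda>x. - (x\<^sup>2 + 2 * x / c + 2 / c\<^sup>2) * exp (- c * x))"
  have deriv: "DERIV F x :> x\<^sup>2 * (c * exp (- c * x))" for x
    unfolding F_def using assms
    by (auto intro!: derivative_eq_intros simp: field_simps power2_eq_square)
  have at_zero: "((F \<circ> real_of_ereal) \<longlongrightarrow> - (2 / c\<^sup>2)) (at_right (ereal 0))"
  proof -
    have "isCont F 0"
      using deriv DERIV_isCont by blast
    then have "(F \<longlongrightarrow> F 0) (at_right 0)"
      using continuous_within continuous_at_imp_continuous_at_within by blast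
    then show ?thesis
      by (simp add: ereal_tendsto_simps F_def)
  qed
  have at_infty: "((F \<circ> real_of_ereal) \<longlongrightarrow> 0) (at_left \<infinity>)"
    unfolding ereal_tendsto_simps F_def using assms by real_asymp
  note FTC = interval_integral_FTC_nonneg[of "ereal 0" \<infinity> F, OF _ deriv _ _ at_zero at_infty]
  show ?int
    using FTC(1) assms by (simp add: einterval_def greaterThan_def)
  have "(LBINT x=ereal 0..\<infinity>. x\<^sup>2 * (c * exp (- c * x))) = 2 / c\<^sup>2"
    using FTC(2) assms by simp
  then show ?val
    by (simp only: interval_integral_to_infinity_eq)
qed

text \<open>
  Integrability and the norm estimate come from the bound \<open>(tx)\<^sup>2\<close> for the compensated character
  and the second moment of the exponential weight. The value is an instance of the fundamental
  theorem of calculus, since the integrand has the antiderivative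
  \<open>- c / (c + \<i>t) * exp (- (c + \<i>t) * x) + (1 - \<i>t * (x + 1 / c)) * exp (- c * x)\<close>.
\<close>

lemma exponential_integral:
  fixes c t :: real
  assumes "c > 0"
  defines "f \<equiv> \<lambda>x. (exp (- (\<i> * of_real t * of_real x)) - 1 + \<i> * of_real t * of_real x)
             * of_real (c * exp (- c * x))"
  shows "set_integrable lborel {0<..} f" (is ?int)
    and "(LBINT x:{0<..}. norm (f x)) \<le> 2 * t\<^sup>2 / c\<^sup>2" (is ?norm)
    and "(LBINT x:{0<..}. f x)
           = \<i> * of_real t * (inverse (of_real c) - inverse (of_real c + \<i> * of_real t))" (is ?val)
proof -
  have cont: "continuous_on UNIV f"
    unfolding f_def by (intro continuous_intros)
  have bound: "norm (f x) \<le> t\<^sup>2 * (x\<^sup>2 * (c * exp (- c * x)))" for x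
  proof -
    have "norm (f x) \<le> (t * x)\<^sup>2 * (c * exp (- c * x))"
      unfolding f_def norm_mult norm_of_real using assms
      by (intro mult_mono norm_compensated_character_le) auto
    then show ?thesis
      by (simp add: power_mult_distrib mult.assoc)
  qed
  have majorant: "set_integrable lborel {0<..} (\<lambda>x. t\<^sup>2 * (x\<^sup>2 * (c * exp (- c * x))))"
    using exponential_second_moment(1)[OF assms(1)] by simp
  show int: ?int
  proof (rule set_integrable_bound[OF majorant])
    show "set_borel_measurable lborel {0<..} f"
      unfolding set_borel_measurable_def using borel_measurable_continuous_onI[OF cont] by measurable
    show "AE x in lborel. x \<in> {0<..} \<longrightarrow> norm (f x) \<le> norm (t\<^sup>2 * (x\<^sup>2 * (c * exp (- c * x))))"
      using bound by (intro AE_I2) (metis abs_ge_self order_trans real_norm_def)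
  qed
  have "(LBINT x:{0<..}. norm (f x)) \<le> (LBINT x:{0<..}. t\<^sup>2 * (x\<^sup>2 * (c * exp (- c * x))))"
    using bound by (intro set_integral_mono set_integrable_norm int majorant)
  then show ?norm
    using exponential_second_moment(2)[OF assms(1)] by (simp add: mult.commute)

  define w where "w = of_real c + \<i> * of_real t"
  have "Re w > 0"
    using assms by (simp add: w_def)
  then have w: "w \<noteq> 0"
    by auto
  define A where "A = (\<lambda>x::real. - of_real c / w * exp (- w * of_real x))"
  define B where "B = (\<lambda>x::real. exp (- c * x))"
  define C where "C = (\<lambda>x::real. - (x + 1 / c) * exp (- c * x))"
  define F where "F = (\<lambda>x::real. A x + of_real (B x) + \<i> * of_real t * of_real (C x))"
  have deriv: "(F has_vector_derivative f x) (at x)" for x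
  proof -
    have "(A has_vector_derivative of_real c * exp (- w * of_real x)) (at x)"
    proof -
      have "((\<lambda>z. - of_real c / w * exp (- w * z)) has_field_derivative
          of_real c * exp (- w * of_real x)) (at (of_real x))"
        using w by (auto intro!: derivative_eq_intros)
      then show ?thesis
        unfolding A_def by (rule has_vector_derivative_real_field)
    qed
    moreover have "(B has_real_derivative - c * exp (- c * x)) (at x)"
      unfolding B_def
      by (auto intro!: derivative_eq_intros)
    moreover have "(C has_real_derivative c * x * exp (- c * x)) (at x)"
      unfolding C_def using assms
      by (auto intro!: derivative_eq_intros simp: field_simps)
    ultimately have "(F has_vector_derivative of_real c * exp (- w * of_real x)
        + of_real (- c * exp (- c * x))
        + \<i> * of_real t * of_real (c * x * exp (- c * x))) (at x)"
      unfolding F_def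
      by (intro has_vector_derivative_add has_vector_derivative_mult_right
          has_vector_derivative_of_real)
    moreover have "exp (- w * of_real x)
        = exp (- (\<i> * of_real t * of_real x)) * of_real (exp (- c * x))"
      by (simp add: w_def exp_of_real[symmetric] exp_add[symmetric] algebra_simps)
    ultimately show ?thesis
      by (simp add: f_def algebra_simps)
  qed
  have at_zero: "((F \<circ> real_of_ereal) \<longlongrightarrow> F 0) (at_right (ereal 0))"
  proof -
    have "isCont F 0"
      using deriv has_vector_derivative_continuous by blast
    then have "(F \<longlongrightarrow> F 0) (at_right 0)"
      using continuous_within continuous_at_imp_continuous_at_within by blast
    then show ?thesis
      by (simp add: ereal_tendsto_simps)
  qed
  have at_infty: "((F \<circ> real_of_ereal) \<longlongrightarrow> 0) (at_left \<infinity>)"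
  proof -
    have B: "(B \<longlongrightarrow> 0) at_top" and C: "(C \<longlongrightarrow> 0) at_top"
      unfolding B_def C_def using assms by real_asymp+
    have "norm (A x) = norm (of_real c / w) * B x" for x
      by (simp add: A_def B_def norm_mult norm_divide w_def)
    then have "((\<lambda>x. norm (A x)) \<longlongrightarrow> norm (of_real c / w) * 0) at_top"
      using tendsto_mult_left[OF B] by presburger
    then have "(A \<longlongrightarrow> 0) at_top"
      by (simp add: tendsto_norm_zero_iff)
    then have "(F \<longlongrightarrow> 0 + of_real 0 + \<i> * of_real t * of_real 0) at_top"
      unfolding F_def by (intro tendsto_intros B C)
    then show ?thesis
      by (simp add: ereal_tendsto_simps)
  qed
  have "(LBINT x=ereal 0..\<infinity>. f x) = 0 - F 0"
  proof (rule interval_integral_FTC_integrable[OF _ deriv _ _ at_zero at_infty])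
    show "isCont f x" for x
      using cont continuous_on_eq_continuous_at by blast
    show "set_integrable lborel (einterval (ereal 0) \<infinity>) f"
      using int by (simp add: einterval_def greaterThan_def)
  qed simp
  also have "(LBINT x=ereal 0..\<infinity>. f x) = (LBINT x:{0<..}. f x)"
    by (simp add: interval_integral_to_infinity_eq)
  also have "0 - F 0
      = \<i> * of_real t * (inverse (of_real c) - inverse (of_real c + \<i> * of_real t))"
  proof -
    have "1 - of_real c / w = \<i> * of_real t / w"
      using w by (simp add: field_simps) (simp add: w_def)
    then show ?thesis
      unfolding w_def[symmetric] by (simp add: F_def A_def B_def C_def field_simps)
  qed
  finally show ?val .
qed

section \<open>Series for the kernel and the digamma function\<close>

text \<open>
  With \<open>q = exp (- x)\<close>, split \<open>(\<beta> + n) * q ^ n\<close> into \<open>(n + 1) * q ^ n + (\<beta> - 1) * q ^ n\<close> and sum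
  both parts.
\<close>

lemma exponential_mixture_sums:
  fixes \<beta> x :: real
  assumes "x > 0"
  shows "(\<lambda>n. (\<beta> + real n) * exp (- (\<beta> + real n) * x)) sums
           (exp (- \<beta> * x) * ((\<beta> * (1 - exp (- x)) + exp (- x)) / (1 - exp (- x))\<^sup>2))"
proof -
  define q where "q = exp (- x)"
  have q: "norm q < 1" "1 - q \<noteq> 0"
    using assms by (auto simp: q_def)
  have "(\<lambda>n. exp (- \<beta> * x) * (of_nat (Suc n) * q ^ n + (\<beta> - 1) * q ^ n)) sums
          (exp (- \<beta> * x) * (1 / (1 - q)\<^sup>2 + (\<beta> - 1) * (1 / (1 - q))))"
    using q by (intro sums_mult sums_add geometric_deriv_sums geometric_sums)
  also have "1 / (1 - q)\<^sup>2 + (\<beta> - 1) * (1 / (1 - q)) = (\<beta> * (1 - q) + q) / (1 - q)\<^sup>2"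
    using q by (simp add: divide_simps power2_eq_square) (simp add: algebra_simps)
  also have "(\<lambda>n. exp (- \<beta> * x) * (of_nat (Suc n) * q ^ n + (\<beta> - 1) * q ^ n))
      = (\<lambda>n. (\<beta> + real n) * exp (- (\<beta> + real n) * x))"
  proof
    fix n
    have "q ^ n = exp (- (real n * x))"
      by (simp add: q_def exp_of_nat_mult[symmetric])
    then show "exp (- \<beta> * x) * (of_nat (Suc n) * q ^ n + (\<beta> - 1) * q ^ n)
        = (\<beta> + real n) * exp (- (\<beta> + real n) * x)"
      by (simp add: algebra_simps exp_add[symmetric] exp_diff exp_minus)
        (simp add: exp_add field_simps)
  qed
  finally show ?thesis
    by (simp add: q_def)
qed

lemma Digamma_diff_sums:
  fixes a b :: complex
  assumes "a \<noteq> 0" "b \<noteq> 0"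
  shows "(\<lambda>n. inverse (b + of_nat n) - inverse (a + of_nat n)) sums (Digamma a - Digamma b)"
  using sums_diff[OF summable_sums[OF summable_Digamma[OF assms(1)]]
      summable_sums[OF summable_Digamma[OF assms(2)]]]
  by (simp add: Digamma_def)

lemma summable_inverse_squares_shifted:
  fixes \<beta> :: real
  assumes "\<beta> > 0"
  shows "summable (\<lambda>n. 1 / (\<beta> + real n)\<^sup>2)"
proof -
  have "(\<lambda>n. inverse ((\<beta> + of_nat n) ^ Suc 1)) sums ((-1) ^ Suc 1 * Polygamma 1 \<beta> / fact 1)"
    using assms by (intro Polygamma_LIMSEQ) auto
  then show ?thesis
    by (simp add: sums_iff inverse_eq_divide power2_eq_square)
qed

section \<open>Termwise integration and reflection\<close>

text \<open>
  The exponential mixture is integrated term by term; the summability of \<open>1 / (\<beta> + n)\<^sup>2\<close> controls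
  the \<open>L\<^sup>1\<close> norms, so the interchange also yields integrability of the sum.
\<close>

lemma Digamma_diff_integral_positive:
  fixes \<beta> t :: real
  assumes "\<beta> > 0"
  defines "f \<equiv> \<lambda>x::real.
           (exp (- (\<i> * of_real t * of_real x)) - 1 + \<i> * of_real t * of_real x)
           * of_real (exp (- \<beta> * x) * ((\<beta> * (1 - exp (- x)) + exp (- x)) / (1 - exp (- x))\<^sup>2))"
  shows "set_integrable lborel {0<..} f" (is ?int)
    and "(LBINT x:{0<..}. f x)
         = \<i> * of_real t * (Digamma (of_real \<beta> + \<i> * of_real t) - Digamma (complex_of_real \<beta>))"
      (is ?val)
proof -
  define e where
    "e = (\<lambda>x::real. exp (- (\<i> * of_real t * of_real x)) - 1 + \<i> * of_real t * of_real x)"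
  define g where
    "g = (\<lambda>n x. indicator {0<..} x *\<^sub>R
            (e x * of_real ((\<beta> + real n) * exp (- (\<beta> + real n) * x))))"
  have pos: "\<beta> + real n > 0" for n
    using assms by simp
  note term_integral = exponential_integral[OF pos, of t, folded e_def]
  have g_int: "integrable lborel (g n)" for n
    using term_integral(1)[of n] by (simp add: g_def set_integrable_def e_def)
  have g_sums: "(\<lambda>n. g n x) sums (indicator {0<..} x *\<^sub>R f x)" for x
  proof (cases "x > 0")
    case True
    then show ?thesis
      unfolding g_def f_def e_def
      by (intro sums_scaleR_right sums_mult sums_of_real exponential_mixture_sums)
  qed (simp add: g_def)
  have g_norm_summable: "summable (\<lambda>n. norm (g n x))" for x
  proof (cases "x > 0")
    case True
    have "summable (\<lambda>n. norm (e x) * ((\<beta> + real n) * exp (- (\<beta> + real n) * x)))"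
      using exponential_mixture_sums[OF True] by (intro summable_mult) (simp add: sums_iff)
    moreover have "norm (g n x) = norm (e x) * ((\<beta> + real n) * exp (- (\<beta> + real n) * x))" for n
      using True pos[of n] unfolding g_def by (simp add: norm_mult del: of_real_mult of_real_add)
    ultimately show ?thesis
      by simp
  qed (simp add: g_def)
  have g_L1_summable: "summable (\<lambda>n. \<integral>x. norm (g n x) \<partial>lborel)"
  proof (rule summable_comparison_test')
    show "summable (\<lambda>n. 2 * t\<^sup>2 * (1 / (\<beta> + real n)\<^sup>2))"
      by (intro summable_mult summable_inverse_squares_shifted assms)
    show "norm (\<integral>x. norm (g n x) \<partial>lborel) \<le> 2 * t\<^sup>2 * (1 / (\<beta> + real n)\<^sup>2)" if "n \<ge> 0" for n
      using term_integral(2)[of n] unfolding g_def set_lebesgue_integral_def e_def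
      by (simp add: integral_nonneg_AE)
  qed
  have g_suminf: "(\<Sum>n. g n x) = indicator {0<..} x *\<^sub>R f x" for x
    using g_sums by (simp add: sums_iff)
  note termwise = g_int AE_I2[OF g_norm_summable] g_L1_summable
  show ?int
    using integrable_suminf[OF termwise] by (simp add: g_suminf set_integrable_def)
  have "(\<lambda>n. integral\<^sup>L lborel (g n)) sums (LBINT x:{0<..}. f x)"
    using sums_integral[OF termwise] by (simp add: g_suminf set_lebesgue_integral_def)
  moreover have "integral\<^sup>L lborel (g n)
      = \<i> * of_real t * (inverse (of_real \<beta> + of_nat n)
          - inverse (of_real \<beta> + \<i> * of_real t + of_nat n))" for n
    using term_integral(3)[of n] by (simp add: g_def set_lebesgue_integral_def e_def add_ac)
  moreover have "(\<lambda>n. \<i> * of_real t * (inverse (of_real \<beta> + of_nat n)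
          - inverse (of_real \<beta> + \<i> * of_real t + of_nat n))) sums
      (\<i> * of_real t * (Digamma (of_real \<beta> + \<i> * of_real t) - Digamma (complex_of_real \<beta>)))"
    using assms by (intro sums_mult Digamma_diff_sums) (auto simp: complex_eq_iff)
  ultimately show ?val
    by (simp add: sums_unique2)
qed

lemma set_integrable_reflect_half_line:
  fixes f :: "real \<Rightarrow> 'a :: euclidean_space"
  assumes "set_integrable lborel {0<..} (\<lambda>x. f (- x))"
  shows "set_integrable lborel {..<0} f"
proof -
  have "indicator {0<..} (- x) = (indicator {..<0} x :: real)" for x :: real
    by (auto simp: indicator_def)
  then show ?thesis
    using lborel_integrable_real_affine[OF assms[unfolded set_integrable_def], of "-1" 0]
    by (simp add: set_integrable_def)
qed

theorem corollary2:
  fixes \<alpha> \<beta> t :: real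
  assumes "\<alpha> > 0" and "\<beta> > 0"
  shows "set_integrable lborel {..<0} (\<lambda>x::real.
           (exp (\<i> * of_real t * of_real x) - 1 - \<i> * of_real t * of_real x)
           * of_real (exp (\<alpha> * x) * ((\<alpha> * (1 - exp x) + exp x) / (1 - exp x)\<^sup>2)))
         \<and> (LBINT x:{..<0}.
           (exp (\<i> * of_real t * of_real x) - 1 - \<i> * of_real t * of_real x)
           * of_real (exp (\<alpha> * x) * ((\<alpha> * (1 - exp x) + exp x) / (1 - exp x)\<^sup>2)))
         = \<i> * of_real t * (Digamma (of_real \<alpha> + \<i> * of_real t) - Digamma (complex_of_real \<alpha>))
         \<and> set_integrable lborel {0<..} (\<lambda>x::real.
           (exp (- (\<i> * of_real t * of_real x)) - 1 + \<i> * of_real t * of_real x)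
           * of_real (exp (- \<beta> * x) * ((\<beta> * (1 - exp (- x)) + exp (- x)) / (1 - exp (- x))\<^sup>2)))
         \<and> (LBINT x:{0<..}.
           (exp (- (\<i> * of_real t * of_real x)) - 1 + \<i> * of_real t * of_real x)
           * of_real (exp (- \<beta> * x) * ((\<beta> * (1 - exp (- x)) + exp (- x)) / (1 - exp (- x))\<^sup>2)))
         = \<i> * of_real t * (Digamma (of_real \<beta> + \<i> * of_real t) - Digamma (complex_of_real \<beta>))"
proof -
  define f where "f = (\<lambda>x::real.
           (exp (\<i> * of_real t * of_real x) - 1 - \<i> * of_real t * of_real x)
           * of_real (exp (\<alpha> * x) * ((\<alpha> * (1 - exp x) + exp x) / (1 - exp x)\<^sup>2)))"
  have reflected: "(\<lambda>x. f (- x)) = (\<lambda>x::real.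
           (exp (- (\<i> * of_real t * of_real x)) - 1 + \<i> * of_real t * of_real x)
           * of_real (exp (- \<alpha> * x) * ((\<alpha> * (1 - exp (- x)) + exp (- x)) / (1 - exp (- x))\<^sup>2)))"
    by (simp add: f_def fun_eq_iff)
  have "set_integrable lborel {..<0} f"
    using Digamma_diff_integral_positive(1)[OF assms(1), of t]
    by (intro set_integrable_reflect_half_line) (simp only: reflected)
  moreover have "(LBINT x:{..<0}. f x) = (LBINT x:{0<..}. f (- x))"
  proof -
    have "{x. - x \<in> {..<0}} = {0::real<..}"
      by auto
    then show ?thesis
      using set_integral_reflect[of "{..<0}" f] by simp
  qed
  ultimately show ?thesis
    using Digamma_diff_integral_positive[OF assms(2), of t]
      Digamma_diff_integral_positive(2)[OF assms(1), of t]
    unfolding reflected[symmetric] f_def[symmetric] by simp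
qed

end
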